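(* Let $(R,\mu)$ be a $\sigma$-finite nonatomic measure space with $\mu(R)=\infty$. Let $X$, $Y$ and $Z$ be quasi-Banach function spaces over $(R,\mu)$, with $X$ being admissible. Assume that $X\overset{*}{\underset{\infty}{\hookrightarrow}} Z$ and $Y\overset{*}{\underset{loc}{\hookrightarrow}} Z$. Let $\{u_n\}_{n=1}^\infty$ be a sequence of $\mu$-measurable functions on $R$ that is bounded in both $X$ and $Y$, and satisfies $$\lim_{n\to\infty}\mu(\{x\in R: |u_n(x)|>\varepsilon\})=0\quad\text{for every }\varepsilon>0.$$ Then $\lim_{n\to\infty}\|u_n\|_Z=0$.
   Context: All sets $E\subseteq R$ are understood to be $\mu$-measurable; $\chi_E$ is the characteristic function of $E$. $\mathscr M(R,\mu)$ is the set of $\mu$-measurable functions on $R$, and $\mathscr M^+(R,\mu)$ its subset of functions nonnegative $\mu$-a.e. A functional $\|\cdot\|_X\colon\mathscr M^+(R,\mu)\to[0,\infty]$ is a quasi-Banach function norm if for all $f,g,f_j\in\mathscr M^+(R,\mu)$: (P1) $\|f\|_X=0$ iff $f=0$ a.e., $\|\lambda f\|_X=\lambda\|f\|_X$ for $\lambda\ge0$, and there is a constant $C_X\in[1,\infty)$ with $\|f+g\|_X\le C_X(\|f\|_X+\|g\|_X)$; (P2) $f\le g$ a.e. implies $\|f\|_X\le\|g\|_X$; (P3) $f_j\nearrow f$ a.e. implies $\|f_j\|_X\nearrow\|f\|_X$; (P4) $\|\chi_E\|_X<\infty$ whenever $\mu(E)<\infty$. It is extended to $\mathscr M(R,\mu)$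 by $\|f\|_X=\|\,|f|\,\|_X$, and $X=\{f\in\mathscr M(R,\mu):\|f\|_X<\infty\}$ is called a quasi-Banach function space (q-BFS). The minimal fundamental function of $X$ is $\varphi^{\min}_X(t)=\inf_{\mu(E)=t}\|\chi_E\|_X$, $t\in[0,\infty)$. $X$ is admissible if $\varphi^{\min}_X(t)>0$ for every $t\in(0,\infty)$. For q-BFSs $X,Y$, write $X\overset{*}{\underset{\infty}{\hookrightarrow}}Y$ if $\lim_{a\to\infty}\sup_{\|f\|_X\le1}\inf_{\mu(E)\le a}\|f\chi_{R\setminus E}\|_Y=0$, and write $X\overset{*}{\underset{loc}{\hookrightarrow}}Y$ if $\lim_{a\to0_+}\sup_{\|f\|_X\le1}\sup_{\mu(E)\le a}\|f\chi_E\|_Y=0$. *)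

theory Defs
  imports "HOL-Analysis.Analysis"
begin

definition measure_atom :: "'a measure \<Rightarrow> 'a set \<Rightarrow> bool" where
  "measure_atom M A \<longleftrightarrow> A \<in> sets M \<and> emeasure M A > 0 \<and>
     (\<forall>B \<in> sets M. B \<subseteq> A \<longrightarrow> emeasure M B = 0 \<or> emeasure M B = emeasure M A)"

definition nonatomic :: "'a measure \<Rightarrow> bool" where
  "nonatomic M \<longleftrightarrow> (\<nexists>A. measure_atom M A)"

text \<open>Measurable functions are extended-real valued: \<open>\<M>(R,\<mu>)\<close> is \<^term>\<open>borel_measurable M\<close>
  at type \<^typ>\<open>'a \<Rightarrow> ereal\<close>, and \<open>\<M>\<^sup>+(R,\<mu>)\<close> is the following set.\<close>

definition nonneg_measurable :: "'a measure \<Rightarrow> ('a \<Rightarrow> ereal) set" where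
  "nonneg_measurable M = {f \<in> borel_measurable M. AE x in M. 0 \<le> f x}"

text \<open>A functional on \<open>\<M>\<^sup>+(R,\<mu>)\<close> is encoded as a total HOL function; its values outside
  \<^term>\<open>nonneg_measurable M\<close> are unconstrained and never used below.\<close>

definition quasi_banach_function_norm ::
    "'a measure \<Rightarrow> (('a \<Rightarrow> ereal) \<Rightarrow> ennreal) \<Rightarrow> bool" where
  "quasi_banach_function_norm M N \<longleftrightarrow>
     (\<forall>f \<in> nonneg_measurable M. N f = 0 \<longleftrightarrow> (AE x in M. f x = 0)) \<and>
     (\<forall>f \<in> nonneg_measurable M. \<forall>c::real. c \<ge> 0 \<longrightarrow>
        N (\<lambda>x. ereal c * f x) = ennreal c * N f) \<and>
     (\<exists>C::real. C \<ge> 1 \<and> (\<forall>f \<in> nonneg_measurable M. \<forall>g \<in> nonneg_measurable M.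
        N (\<lambda>x. f x + g x) \<le> ennreal C * (N f + N g))) \<and>
     (\<forall>f \<in> nonneg_measurable M. \<forall>g \<in> nonneg_measurable M.
        (AE x in M. f x \<le> g x) \<longrightarrow> N f \<le> N g) \<and>
     (\<forall>F f. (\<forall>j::nat. F j \<in> nonneg_measurable M) \<longrightarrow> f \<in> nonneg_measurable M \<longrightarrow>
        (AE x in M. incseq (\<lambda>j. F j x) \<and> (\<lambda>j. F j x) \<longlonglongrightarrow> f x) \<longrightarrow>
        incseq (\<lambda>j. N (F j)) \<and> (\<lambda>j. N (F j)) \<longlonglongrightarrow> N f) \<and>
     (\<forall>E \<in> sets M. emeasure M E < \<infinity> \<longrightarrow> N (indicator E) < \<infinity>)"

text \<open>The extension of the functional from \<open>\<M>\<^sup>+(R,\<mu>)\<close> to \<open>\<M>(R,\<mu>)\<close>.\<close>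

definition fnorm :: "(('a \<Rightarrow> ereal) \<Rightarrow> ennreal) \<Rightarrow> ('a \<Rightarrow> ereal) \<Rightarrow> ennreal" where
  "fnorm N f = N (\<lambda>x. \<bar>f x\<bar>)"

definition function_space :: "'a measure \<Rightarrow> (('a \<Rightarrow> ereal) \<Rightarrow> ennreal) \<Rightarrow> ('a \<Rightarrow> ereal) set" where
  "function_space M N = {f \<in> borel_measurable M. fnorm N f < \<infinity>}"

definition bounded_in_space ::
    "'a measure \<Rightarrow> (('a \<Rightarrow> ereal) \<Rightarrow> ennreal) \<Rightarrow> ('a \<Rightarrow> ereal) set \<Rightarrow> bool" where
  "bounded_in_space M N A \<longleftrightarrow>
     A \<subseteq> function_space M N \<and> (\<exists>K::real. \<forall>f \<in> A. fnorm N f \<le> ennreal K)"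

definition min_fundamental ::
    "'a measure \<Rightarrow> (('a \<Rightarrow> ereal) \<Rightarrow> ennreal) \<Rightarrow> real \<Rightarrow> ennreal" where
  "min_fundamental M N t =
     (INF E \<in> {E \<in> sets M. emeasure M E = ennreal t}. fnorm N (indicator E))"

definition admissible :: "'a measure \<Rightarrow> (('a \<Rightarrow> ereal) \<Rightarrow> ennreal) \<Rightarrow> bool" where
  "admissible M N \<longleftrightarrow> (\<forall>t > 0. min_fundamental M N t > 0)"

definition almost_compact_infty ::
    "'a measure \<Rightarrow> (('a \<Rightarrow> ereal) \<Rightarrow> ennreal) \<Rightarrow> (('a \<Rightarrow> ereal) \<Rightarrow> ennreal) \<Rightarrow> bool" where
  "almost_compact_infty M NX NY \<longleftrightarrow>
     ((\<lambda>a::real. SUP f \<in> {f \<in> borel_measurable M. fnorm NX f \<le> 1}.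
         INF E \<in> {E \<in> sets M. emeasure M E \<le> ennreal a}.
           fnorm NY (\<lambda>x. f x * indicator (space M - E) x)) \<longlongrightarrow> 0) at_top"

definition almost_compact_loc ::
    "'a measure \<Rightarrow> (('a \<Rightarrow> ereal) \<Rightarrow> ennreal) \<Rightarrow> (('a \<Rightarrow> ereal) \<Rightarrow> ennreal) \<Rightarrow> bool" where
  "almost_compact_loc M NX NY \<longleftrightarrow>
     ((\<lambda>a::real. SUP f \<in> {f \<in> borel_measurable M. fnorm NX f \<le> 1}.
         SUP E \<in> {E \<in> sets M. emeasure M E \<le> ennreal a}.
           fnorm NY (\<lambda>x. f x * indicator E x)) \<longlongrightarrow> 0) (at_right 0)"

end

theory Submission
  imports Defs
begin

text \<open>
  The key point is that \<open>\<parallel>\<chi>\<^sub>E\<parallel>\<^sub>Z\<close> is bounded uniformly over all sets with \<open>\<mu>(E) \<le> a\<close>. Halving sets,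
  which is possible since \<open>\<mu>\<close> is nonatomic, shows that unboundedness on sets of measure at most
  \<open>a\<close> forces unboundedness on sets of measure at most \<open>a/2\<^sup>k\<close> for every \<open>k\<close>; a union of sets
  \<open>E\<^sub>k\<close> with \<open>\<mu>(E\<^sub>k) \<le> a/2\<^sup>k\<close> and \<open>\<parallel>\<chi>\<^bsub>E\<^sub>k\<^esub>\<parallel>\<^sub>Z \<ge> k\<close> then has finite measure but infinite norm,
  contradicting (P4).

  Given \<open>\<delta> > 0\<close>, let \<open>G\<^sub>n = {|u\<^sub>n| > \<delta>}\<close>, and let \<open>E\<^sub>n\<close> be a set of measure at most \<open>a\<close> outside of
  which \<open>u\<^sub>n\<close> is small in \<open>Z\<close>. Then \<open>|u\<^sub>n| \<le> |u\<^sub>n| \<chi>\<^bsub>G\<^sub>n\<^esub> + |u\<^sub>n| \<chi>\<^bsub>R - E\<^sub>n\<^esub> + \<delta> \<chi>\<^bsub>E\<^sub>n\<^esub>\<close>, where the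
  first term is controlled by the local embedding because \<open>\<mu>(G\<^sub>n) \<rightarrow> 0\<close>, the second one by the
  choice of \<open>E\<^sub>n\<close>, and the third one by the uniform bound, once \<open>\<delta>\<close> is small.
\<close>

section \<open>Nonatomic measures\<close>

lemma nonatomic_split:
  assumes "nonatomic M" "A \<in> sets M" "emeasure M A > 0"
  obtains B where "B \<in> sets M" "B \<subseteq> A" "emeasure M B \<noteq> 0" "emeasure M B \<noteq> emeasure M A"
  using assms unfolding nonatomic_def measure_atom_def by blast

text \<open>A set of positive measure that is not an atom splits into \<open>D\<close> and
  \<open>B - D\<close>, both of positive measure, and one of them has at most half the measure of
  \<open>B\<close>. Each further split contributes another factor 1/2.\<close>

lemma nonatomic_dyadic_small_subset:
  assumes "nonatomic M" "E \<in> fmeasurable M" "measure M E > 0"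
  shows "\<exists>B \<in> fmeasurable M. B \<subseteq> E \<and> 0 < measure M B \<and> measure M B \<le> measure M E / 2 ^ n"
proof (induction n)
  case 0
  then show ?case using assms by auto
next
  case (Suc n)
  then obtain B where B: "B \<in> fmeasurable M" "B \<subseteq> E" "0 < measure M B"
    "measure M B \<le> measure M E / 2 ^ n" by blast
  have "emeasure M B > 0"
    using B by (simp add: emeasure_eq_measure2)
  then obtain D where D: "D \<in> sets M" "D \<subseteq> B" "emeasure M D \<noteq> 0" "emeasure M D \<noteq> emeasure M B"
    using nonatomic_split[OF assms(1)] B(1) by (metis fmeasurableD)
  have Df: "D \<in> fmeasurable M"
    using B(1) D by (metis fmeasurableI2)
  have diff: "measure M (B - D) = measure M B - measure M D"
    using B(1) Df D(2) by (intro measure_Diff) (auto simp: fmeasurableD fmeasurableD2)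
  have "measure M D > 0" "measure M D \<noteq> measure M B"
    using D Df B(1) by (auto simp: emeasure_eq_measure2 zero_less_measure_iff)
  moreover have "measure M D \<le> measure M B"
    using B(1) D by (simp add: measure_mono_fmeasurable)
  ultimately have lt: "0 < measure M D" "measure M D < measure M B" by auto
  have half: "measure M B / 2 \<le> measure M E / 2 ^ Suc n"
    using B(4) by simp
  show ?case
  proof (cases "measure M D \<le> measure M B / 2")
    case True
    then show ?thesis
      using Df D(2) B(2) lt half by (intro bexI[of _ D]) auto
  next
    case False
    then show ?thesis
      using Df B lt diff half by (intro bexI[of _ "B - D"]) auto
  qed
qed

lemma nonatomic_small_subset:
  assumes "nonatomic M" "E \<in> fmeasurable M" "measure M E > 0" "(e::real) > 0"
  obtains B where "B \<in> fmeasurable M" "B \<subseteq> E" "0 < measure M B" "measure M B \<le> e"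
proof -
  obtain n where "measure M E / e < 2 ^ n"
    using real_arch_pow[of 2] by auto
  then have "measure M E / 2 ^ n \<le> e"
    using assms(4) by (simp add: field_simps)
  then show ?thesis
    using nonatomic_dyadic_small_subset[OF assms(1-3), of n] that by force
qed

text \<open>Sierpinski's theorem, by greedy exhaustion: among the subsets of \<open>E\<close> of
  measure at most \<open>s\<close>, an increasing sequence is built in which every step realizes at
  least half of the gain still possible. Its union cannot fall short of \<open>s\<close>.\<close>

lemma nonatomic_subset_of_measure:
  assumes "nonatomic M" "E \<in> fmeasurable M" "0 \<le> s" "s \<le> measure M E"
  obtains B where "B \<in> fmeasurable M" "B \<subseteq> E" "measure M B = s"
proof -
  define S where "S = {B \<in> fmeasurable M. B \<subseteq> E \<and> measure M B \<le> s}"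
  have step: "\<exists>A'\<in>S. A \<subseteq> A' \<and>
      (\<forall>B\<in>S. A \<subseteq> B \<longrightarrow> measure M B - measure M A \<le> 2 * (measure M A' - measure M A))"
    if A: "A \<in> S" for A
  proof -
    define T where "T = measure M ` {B \<in> S. A \<subseteq> B}"
    have bdd: "bdd_above T"
      unfolding T_def S_def by (rule bdd_aboveI[of _ s]) auto
    have ne: "T \<noteq> {}" using A unfolding T_def by auto
    have up: "measure M B \<le> Sup T" if "B \<in> S" "A \<subseteq> B" for B
      using that bdd by (intro cSup_upper) (auto simp: T_def)
    show ?thesis
    \<comment> \<open>Either nothing can be gained and \<open>A\<close> itself serves as
      \<open>A'\<close>, or some \<open>A'\<close> passes the midpoint between
      \<open>measure M A\<close> and the supremum.\<close>
    proof (cases "Sup T \<le> measure M A")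
      case True
      then show ?thesis using A up by (intro bexI[of _ A]) force+
    next
      case False
      then have "(Sup T + measure M A) / 2 < Sup T" by auto
      then obtain A' where "A' \<in> S" "A \<subseteq> A'" "(Sup T + measure M A) / 2 < measure M A'"
        using less_cSupD[OF ne] unfolding T_def by blast
      then show ?thesis using up by (intro bexI[of _ A']) force+
    qed
  qed
  have "{} \<in> S" using assms(3) by (simp add: S_def)
  then have "\<exists>A. \<forall>n::nat. A n \<in> S \<and> (A n \<subseteq> A (Suc n) \<and> (\<forall>B\<in>S. A n \<subseteq> B \<longrightarrow>
      measure M B - measure M (A n) \<le> 2 * (measure M (A (Suc n)) - measure M (A n))))"
    by (intro dependent_nat_choice) (blast, metis step)
  then obtain A where A: "\<And>n::nat. A n \<in> S" "\<And>n. A n \<subseteq> A (Suc n)"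
    and gap: "\<And>n B. B \<in> S \<Longrightarrow> A n \<subseteq> B \<Longrightarrow>
      measure M B - measure M (A n) \<le> 2 * (measure M (A (Suc n)) - measure M (A n))"
    by blast
  define U where "U = (\<Union>n. A n)"
  have UE: "U \<subseteq> E" using A(1) by (auto simp: U_def S_def)
  have "U \<in> sets M" using A(1) by (auto simp: U_def S_def)
  then have Uf: "U \<in> fmeasurable M" using UE assms(2) by (metis fmeasurableI2)
  have inc: "incseq A" using A(2) by (simp add: incseq_SucI)
  have lim: "(\<lambda>n. measure M (A n)) \<longlonglongrightarrow> measure M U"
    unfolding U_def using A(1) inc Uf[THEN fmeasurableD2]
    by (intro Lim_measure_incseq) (auto simp: S_def U_def)
  have le: "measure M U \<le> s"
    using A(1) by (intro LIMSEQ_le_const2[OF lim]) (auto simp: S_def)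
  have "measure M U = s"
  proof (rule ccontr)
    assume "measure M U \<noteq> s"
    with le have lt: "measure M U < s" by simp
    have "measure M (E - U) = measure M E - measure M U"
      using assms(2) Uf UE by (intro measure_Diff) (auto simp: fmeasurableD fmeasurableD2)
    then have "measure M (E - U) > 0" using lt assms(4) by simp
    moreover have "E - U \<in> fmeasurable M" using assms(2) Uf by auto
    ultimately obtain D where D: "D \<in> fmeasurable M" "D \<subseteq> E - U" "0 < measure M D"
      "measure M D \<le> s - measure M U"
      using nonatomic_small_subset[OF assms(1), of "E - U" "s - measure M U"] lt by auto
    have "U \<inter> D = {}" using D(2) by blast
    then have UD: "measure M (U \<union> D) = measure M U + measure M D"
      using measure_Un3[OF Uf D(1)] by simp
    \<comment> \<open>\<open>U \<union> D\<close> contains every \<open>A n\<close>, so it competes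
      at each step of the exhaustion. In the limit the realized gain on the right tends to 0, while
      the left side tends to \<open>measure M D > 0\<close>.\<close>
    have "U \<union> D \<in> S"
      using Uf D UE UD by (auto simp: S_def)
    then have "measure M U + measure M D - measure M (A n)
        \<le> 2 * (measure M (A (Suc n)) - measure M (A n))" for n
      using gap[of "U \<union> D" n] UD by (auto simp: U_def)
    then have "measure M U + measure M D - measure M U \<le> 2 * (measure M U - measure M U)"
      by (intro LIMSEQ_le[OF tendsto_diff[OF tendsto_const lim]
            tendsto_mult[OF tendsto_const tendsto_diff[OF LIMSEQ_Suc[OF lim] lim]]]) auto
    with D(3) show False by simp
  qed
  then show ?thesis using that Uf UE by blast
qed

section \<open>Quasi-Banach function norms\<close>

lemma abs_nonneg_measurable:
  "f \<in> borel_measurable M \<Longrightarrow> (\<lambda>x. \<bar>f x\<bar>) \<in> nonneg_measurable M"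
  by (simp add: nonneg_measurable_def)

lemma fnorm_mono:
  assumes "quasi_banach_function_norm M N" "f \<in> borel_measurable M" "g \<in> borel_measurable M"
    and "AE x in M. \<bar>f x\<bar> \<le> \<bar>g x\<bar>"
  shows "fnorm N f \<le> fnorm N g"
proof -
  have "\<forall>f \<in> nonneg_measurable M. \<forall>g \<in> nonneg_measurable M.
      (AE x in M. f x \<le> g x) \<longrightarrow> N f \<le> N g"
    using assms(1) unfolding quasi_banach_function_norm_def by (elim conjE)
  from this[rule_format, OF abs_nonneg_measurable abs_nonneg_measurable, OF assms(2-4)]
  show ?thesis unfolding fnorm_def .
qed

lemma fnorm_scale:
  assumes "quasi_banach_function_norm M N" "f \<in> borel_measurable M" "c \<ge> 0"
  shows "fnorm N (\<lambda>x. ereal c * f x) = ennreal c * fnorm N f"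
proof -
  have "\<forall>f \<in> nonneg_measurable M. \<forall>c::real. c \<ge> 0 \<longrightarrow>
      N (\<lambda>x. ereal c * f x) = ennreal c * N f"
    using assms(1) unfolding quasi_banach_function_norm_def by (elim conjE)
  from this[rule_format, OF abs_nonneg_measurable, OF assms(2,3)] show ?thesis
    using assms(3) by (simp add: fnorm_def ereal_abs_mult)
qed

text \<open>Combines (P1) with (P2). Stating the hypothesis as a pointwise bound of absolute values
  allows signed functions and avoids sums of opposite infinities.\<close>

lemma fnorm_quasi_triangle:
  assumes N: "quasi_banach_function_norm M N"
  obtains C :: real where "C \<ge> 1"
    "\<And>f g h. f \<in> borel_measurable M \<Longrightarrow> g \<in> borel_measurable M \<Longrightarrow> h \<in> borel_measurable M \<Longrightarrow>
       AE x in M. \<bar>f x\<bar> \<le> \<bar>g x\<bar> + \<bar>h x\<bar> \<Longrightarrow> fnorm N f \<le> ennreal C * (fnorm N g + fnorm N h)"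
proof -
  have "\<exists>C::real. C \<ge> 1 \<and> (\<forall>f \<in> nonneg_measurable M. \<forall>g \<in> nonneg_measurable M.
      N (\<lambda>x. f x + g x) \<le> ennreal C * (N f + N g))"
    using N unfolding quasi_banach_function_norm_def by (elim conjE)
  then obtain C :: real where C: "C \<ge> 1" "\<forall>f \<in> nonneg_measurable M. \<forall>g \<in> nonneg_measurable M.
      N (\<lambda>x. f x + g x) \<le> ennreal C * (N f + N g)"
    by (elim exE conjE)
  show ?thesis
  proof (rule that[OF C(1)])
    fix f g h :: "'a \<Rightarrow> ereal"
    assume m: "f \<in> borel_measurable M" "g \<in> borel_measurable M" "h \<in> borel_measurable M"
      and le: "AE x in M. \<bar>f x\<bar> \<le> \<bar>g x\<bar> + \<bar>h x\<bar>"
    have "fnorm N f \<le> fnorm N (\<lambda>x. \<bar>g x\<bar> + \<bar>h x\<bar>)"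
      using m le by (intro fnorm_mono[OF N]) auto
    also have "\<dots> = N (\<lambda>x. \<bar>g x\<bar> + \<bar>h x\<bar>)"
      by (simp add: fnorm_def)
    also have "\<dots> \<le> ennreal C * (fnorm N g + fnorm N h)"
      unfolding fnorm_def using m by (intro C(2)[rule_format] abs_nonneg_measurable)
    finally show "fnorm N f \<le> ennreal C * (fnorm N g + fnorm N h)" .
  qed
qed

lemma fnorm_indicator_finite:
  assumes "quasi_banach_function_norm M N" "E \<in> sets M" "emeasure M E < \<infinity>"
  shows "fnorm N (indicator E) < \<infinity>"
proof -
  have "(\<lambda>x. \<bar>indicator E x :: ereal\<bar>) = indicator E"
    by (auto simp: indicator_def)
  then show ?thesis
    using assms unfolding quasi_banach_function_norm_def fnorm_def by auto
qed

section \<open>Uniform bounds for norms of characteristic functions\<close>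

text \<open>If \<open>B\<close> bounded the norms on the scale \<open>a / 2\<close>, cutting a set
  into two halves of equal measure would bound them on the scale \<open>a\<close>, at the price of
  the quasi-triangle constant.\<close>

lemma fnorm_indicator_unbounded_halve:
  assumes na: "nonatomic M" and N: "quasi_banach_function_norm M N" and "a > 0"
    and unb: "\<And>B::real. \<exists>E \<in> sets M. emeasure M E \<le> ennreal a \<and> fnorm N (indicator E) > ennreal B"
  shows "\<exists>E \<in> sets M. emeasure M E \<le> ennreal (a / 2) \<and> fnorm N (indicator E) > ennreal B"
proof (rule ccontr)
  assume "\<not> ?thesis"
  then have le: "fnorm N (indicator E) \<le> ennreal B"
    if "E \<in> sets M" "emeasure M E \<le> ennreal (a / 2)" for E
    using that by (meson not_le)
  obtain C :: real where C: "C \<ge> 1"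
    "\<And>f g h. f \<in> borel_measurable M \<Longrightarrow> g \<in> borel_measurable M \<Longrightarrow> h \<in> borel_measurable M \<Longrightarrow>
       AE x in M. \<bar>f x\<bar> \<le> \<bar>g x\<bar> + \<bar>h x\<bar> \<Longrightarrow> fnorm N f \<le> ennreal C * (fnorm N g + fnorm N h)"
    using fnorm_quasi_triangle[OF N] by blast
  obtain E where E: "E \<in> sets M" "emeasure M E \<le> ennreal a"
    \<comment> \<open>The threshold is exactly the bound that the two halves of \<open>E\<close>
      will give; \<open>max 0 B\<close> matches the truncation of negative reals by
      \<open>ennreal\<close>.\<close>
    "fnorm N (indicator E) > ennreal (C * (max 0 B + max 0 B))"
    using unb by blast
  have Ef: "E \<in> fmeasurable M"
    using E by (auto intro!: fmeasurableI simp: le_less_trans)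
  then have mE: "measure M E \<le> a"
    using E(2) \<open>a > 0\<close> by (simp add: emeasure_eq_measure2)
  obtain A where A: "A \<in> fmeasurable M" "A \<subseteq> E" "measure M A = measure M E / 2"
    using nonatomic_subset_of_measure[OF na Ef, of "measure M E / 2"] by auto
  have "measure M (E - A) = measure M E / 2"
    using Ef A by (subst measure_Diff) (auto simp: fmeasurableD2 fmeasurableD)
  then have "fnorm N (indicator A) \<le> ennreal B" "fnorm N (indicator (E - A)) \<le> ennreal B"
    using A Ef mE \<open>a > 0\<close> by (auto intro!: le simp: emeasure_eq_measure2 fmeasurable_Diff fmeasurableD)
  then have b: "fnorm N (indicator A) + fnorm N (indicator (E - A))
      \<le> ennreal (max 0 B) + ennreal (max 0 B)"
    by (intro add_mono) (auto simp: max_def ennreal_neg)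
  have "fnorm N (indicator E) \<le> ennreal C * (fnorm N (indicator A) + fnorm N (indicator (E - A)))"
    using A Ef by (intro C(2) borel_measurable_indicator AE_I2)
      (auto simp: indicator_def fmeasurableD)
  also have "\<dots> \<le> ennreal C * (ennreal (max 0 B) + ennreal (max 0 B))"
    using b by (rule mult_left_mono) simp
  also have "\<dots> = ennreal (C * (max 0 B + max 0 B))"
    using C(1) by (simp add: ennreal_mult'' ennreal_plus[symmetric] del: ennreal_plus)
  finally show False using E(3) by simp
qed

text \<open>Upgrades the setwise finiteness in (P4) to a uniform bound. The constants lost in
  repeated halving do no harm, since unboundedness is carried to each scale for all \<open>B\<close>
  at once, and the union of the small sets is compared with its members by monotonicity
  alone.\<close>

lemma fnorm_indicator_bounded:
  assumes na: "nonatomic M" and N: "quasi_banach_function_norm M N" and "a > 0"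
  obtains B :: real where
    "\<And>E. E \<in> sets M \<Longrightarrow> emeasure M E \<le> ennreal a \<Longrightarrow> fnorm N (indicator E) \<le> ennreal B"
proof (rule ccontr)
  assume "\<not> thesis"
  then have unb0: "\<exists>E \<in> sets M. emeasure M E \<le> ennreal a \<and> fnorm N (indicator E) > ennreal B"
    for B :: real
    using that by (meson not_le)
  have unb: "\<exists>E \<in> sets M. emeasure M E \<le> ennreal (a / 2 ^ k) \<and> fnorm N (indicator E) > ennreal B"
    for B :: real and k :: nat
  \<comment> \<open>The bound must vary, because halving needs unboundedness beyond every bound on
    the previous scale.\<close>
  proof (induction k arbitrary: B)
    case 0
    then show ?case using unb0 by simp
  next
    case (Suc k)
    have "a / 2 ^ k > 0" using \<open>a > 0\<close> by simp
    from fnorm_indicator_unbounded_halve[OF na N this Suc] show ?case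
      by (simp add: mult.commute)
  qed
  then have "\<forall>k. \<exists>E. E \<in> sets M \<and> emeasure M E \<le> ennreal (a / 2 ^ k) \<and>
      fnorm N (indicator E) > ennreal (real k)"
    by blast
  then obtain E where E: "\<And>k. E k \<in> sets M" "\<And>k. emeasure M (E k) \<le> ennreal (a / 2 ^ k)"
    "\<And>k. fnorm N (indicator (E k)) > ennreal (real k)"
    by metis
  define U where "U = (\<Union>k. E k)"
  have U: "U \<in> sets M" using E(1) by (auto simp: U_def)
  have "(\<lambda>k. a * (1 / 2) ^ k) sums (a * (1 / (1 - 1 / 2)))"
    by (intro sums_mult geometric_sums) auto
  moreover have "(\<lambda>k. a * (1 / 2) ^ k) = (\<lambda>k. a / 2 ^ k)"
    by (simp add: power_one_over)
  ultimately have "(\<lambda>k. a / 2 ^ k) sums (2 * a)"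
    by (simp add: mult.commute)
  then have s: "(\<Sum>k. ennreal (a / 2 ^ k)) = ennreal (2 * a)"
    using \<open>a > 0\<close> by (intro suminf_ennreal_eq) auto
  have "emeasure M U \<le> (\<Sum>k. emeasure M (E k))"
    unfolding U_def using E(1) by (intro emeasure_subadditive_countably) auto
  also have "\<dots> \<le> (\<Sum>k. ennreal (a / 2 ^ k))"
    using E(2) by (intro suminf_le) auto
  finally have "emeasure M U < \<infinity>"
    using s by (simp add: le_less_trans)
  then have "fnorm N (indicator U) < \<infinity>"
    using fnorm_indicator_finite[OF N U] by simp
  then obtain k :: nat where k: "fnorm N (indicator U) < of_nat k"
    using ennreal_Ex_less_of_nat by auto
  have "fnorm N (indicator (E k)) \<le> fnorm N (indicator U)"
    using E(1) U by (intro fnorm_mono[OF N] borel_measurable_indicator AE_I2)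
      (auto simp: indicator_def U_def)
  then show False
    using E(3)[of k] k by (simp add: ennreal_of_nat_eq_real_of_nat)
qed

section \<open>Almost compact embeddings\<close>

text \<open>The almost compact embeddings quantify over the unit ball, so a function of norm at most
  \<open>K\<close> is first divided by \<open>K\<close>; the next lemma undoes this after
  restriction to a set.\<close>

lemma fnorm_normalize:
  assumes "quasi_banach_function_norm M N" "f \<in> borel_measurable M" "K > 0"
    and "fnorm N f \<le> ennreal K"
  shows "fnorm N (\<lambda>x. ereal (1 / K) * f x) \<le> 1"
proof -
  have "fnorm N (\<lambda>x. ereal (1 / K) * f x) = ennreal (1 / K) * fnorm N f"
    using assms by (intro fnorm_scale) auto
  also have "\<dots> \<le> ennreal (1 / K) * ennreal K"
    using assms(4) by (rule mult_left_mono) simp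
  also have "\<dots> = 1"
    using assms(3) by (simp add: ennreal_mult''[symmetric])
  finally show ?thesis .
qed

lemma fnorm_unnormalize:
  assumes "quasi_banach_function_norm M N" "f \<in> borel_measurable M" "E \<in> sets M" "K > 0" "r > 0"
    and "fnorm N (\<lambda>x. (ereal (1 / K) * f x) * indicator E x) \<le> ennreal r"
  shows "fnorm N (\<lambda>x. f x * indicator E x) \<le> ennreal (K * r)"
proof -
  \<comment> \<open>The cancellation is valid at infinite values of \<open>f\<close> too, since
    multiplication of extended reals is associative.\<close>
  have eq: "(\<lambda>x. f x * indicator E x)
      = (\<lambda>x. ereal K * ((ereal (1 / K) * f x) * indicator E x))"
    using assms(4) by (simp add: mult.assoc[symmetric] one_ereal_def[symmetric])
  have "fnorm N (\<lambda>x. f x * indicator E x)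
      = ennreal K * fnorm N (\<lambda>x. (ereal (1 / K) * f x) * indicator E x)"
    unfolding eq using assms by (intro fnorm_scale) auto
  also have "\<dots> \<le> ennreal K * ennreal r"
    using assms(6) by (rule mult_left_mono) simp
  finally show ?thesis
    using assms(4,5) by (simp add: ennreal_mult'')
qed

lemma almost_compact_locD:
  assumes NX: "quasi_banach_function_norm M NX" and NY: "quasi_banach_function_norm M NY"
    and ac: "almost_compact_loc M NX NY" and "K > 0" "r > 0"
  obtains a :: real where "a > 0"
    "\<And>f E. f \<in> borel_measurable M \<Longrightarrow> fnorm NX f \<le> ennreal K \<Longrightarrow> E \<in> sets M \<Longrightarrow>
       emeasure M E \<le> ennreal a \<Longrightarrow> fnorm NY (\<lambda>x. f x * indicator E x) \<le> ennreal (K * r)"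
proof -
  have "\<forall>\<^sub>F a in at_right (0::real). (SUP f \<in> {f \<in> borel_measurable M. fnorm NX f \<le> 1}.
         SUP E \<in> {E \<in> sets M. emeasure M E \<le> ennreal a}.
           fnorm NY (\<lambda>x. f x * indicator E x)) < ennreal r"
    using ac \<open>r > 0\<close> unfolding almost_compact_loc_def by (intro order_tendstoD(2)) auto
  then have "\<forall>\<^sub>F a in at_right (0::real). a > 0 \<and> (SUP f \<in> {f \<in> borel_measurable M. fnorm NX f \<le> 1}.
         SUP E \<in> {E \<in> sets M. emeasure M E \<le> ennreal a}.
           fnorm NY (\<lambda>x. f x * indicator E x)) < ennreal r"
    by (intro eventually_conj) (auto simp: eventually_at_right_less)
  then obtain a :: real where a: "a > 0" "(SUP f \<in> {f \<in> borel_measurable M. fnorm NX f \<le> 1}.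
         SUP E \<in> {E \<in> sets M. emeasure M E \<le> ennreal a}.
           fnorm NY (\<lambda>x. f x * indicator E x)) < ennreal r"
    using eventually_happens'[OF trivial_limit_at_right_real] by blast
  show ?thesis
  proof (rule that[OF a(1)])
    fix f :: "'a \<Rightarrow> ereal" and E
    assume f: "f \<in> borel_measurable M" "fnorm NX f \<le> ennreal K"
      and E: "E \<in> sets M" "emeasure M E \<le> ennreal a"
    have g: "(\<lambda>x. ereal (1 / K) * f x) \<in> {f \<in> borel_measurable M. fnorm NX f \<le> 1}"
      using fnorm_normalize[OF NX f(1) \<open>K > 0\<close> f(2)] f(1) by simp
    have "fnorm NY (\<lambda>x. (ereal (1 / K) * f x) * indicator E x) \<le> ennreal r"
      using E by (intro order_trans[OF _ less_imp_le[OF a(2)]] SUP_upper2[OF g] SUP_upper2[of E]) auto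
    then show "fnorm NY (\<lambda>x. f x * indicator E x) \<le> ennreal (K * r)"
      using fnorm_unnormalize[OF NY f(1) E(1)] \<open>K > 0\<close> \<open>r > 0\<close> by blast
  qed
qed

lemma almost_compact_inftyD:
  assumes NX: "quasi_banach_function_norm M NX" and NY: "quasi_banach_function_norm M NY"
    and ac: "almost_compact_infty M NX NY" and "K > 0" "r > 0"
  obtains a :: real where "a > 0"
    "\<And>f. f \<in> borel_measurable M \<Longrightarrow> fnorm NX f \<le> ennreal K \<Longrightarrow>
       \<exists>E \<in> sets M. emeasure M E \<le> ennreal a \<and>
         fnorm NY (\<lambda>x. f x * indicator (space M - E) x) \<le> ennreal (K * r)"
proof -
  have "\<forall>\<^sub>F a in at_top. (SUP f \<in> {f \<in> borel_measurable M. fnorm NX f \<le> 1}.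
         INF E \<in> {E \<in> sets M. emeasure M E \<le> ennreal a}.
           fnorm NY (\<lambda>x. f x * indicator (space M - E) x)) < ennreal r"
    using ac \<open>r > 0\<close> unfolding almost_compact_infty_def by (intro order_tendstoD(2)) auto
  then have "\<forall>\<^sub>F a in at_top. a > 0 \<and> (SUP f \<in> {f \<in> borel_measurable M. fnorm NX f \<le> 1}.
         INF E \<in> {E \<in> sets M. emeasure M E \<le> ennreal a}.
           fnorm NY (\<lambda>x. f x * indicator (space M - E) x)) < ennreal r"
    by (intro eventually_conj eventually_gt_at_top)
  then obtain a :: real where a: "a > 0" "(SUP f \<in> {f \<in> borel_measurable M. fnorm NX f \<le> 1}.
         INF E \<in> {E \<in> sets M. emeasure M E \<le> ennreal a}.
           fnorm NY (\<lambda>x. f x * indicator (space M - E) x)) < ennreal r"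
    using eventually_happens'[OF trivial_limit_at_top_linorder] by blast
  show ?thesis
  proof (rule that[OF a(1)])
    fix f :: "'a \<Rightarrow> ereal"
    assume f: "f \<in> borel_measurable M" "fnorm NX f \<le> ennreal K"
    have g: "(\<lambda>x. ereal (1 / K) * f x) \<in> {f \<in> borel_measurable M. fnorm NX f \<le> 1}"
      using fnorm_normalize[OF NX f(1) \<open>K > 0\<close> f(2)] f(1) by simp
    \<comment> \<open>The infimum need not be attained; the strict bound by \<open>r\<close> is what
      supplies an actual set \<open>E\<close>.\<close>
    have "(INF E \<in> {E \<in> sets M. emeasure M E \<le> ennreal a}.
        fnorm NY (\<lambda>x. (ereal (1 / K) * f x) * indicator (space M - E) x)) < ennreal r"
      by (rule le_less_trans[OF SUP_upper2[OF g order_refl] a(2)])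
    then obtain E where E: "E \<in> sets M" "emeasure M E \<le> ennreal a"
      "fnorm NY (\<lambda>x. (ereal (1 / K) * f x) * indicator (space M - E) x) < ennreal r"
      by (auto simp: INF_less_iff)
    then have "fnorm NY (\<lambda>x. f x * indicator (space M - E) x) \<le> ennreal (K * r)"
      using fnorm_unnormalize[OF NY f(1), of "space M - E" K r] \<open>K > 0\<close> \<open>r > 0\<close> by auto
    with E show "\<exists>E \<in> sets M. emeasure M E \<le> ennreal a \<and>
         fnorm NY (\<lambda>x. f x * indicator (space M - E) x) \<le> ennreal (K * r)" by blast
  qed
qed

lemma bounded_in_space_rangeD:
  assumes "bounded_in_space M N (range u)"
  obtains K :: real where "K > 0" "\<And>n. fnorm N (u n) \<le> ennreal K"
proof -
  obtain K :: real where K: "\<And>n. fnorm N (u n) \<le> ennreal K"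
    using assms unfolding bounded_in_space_def by auto
  \<comment> \<open>The given \<open>K\<close> may be zero or negative, but normalization divides by
    it.\<close>
  have "fnorm N (u n) \<le> ennreal (max 1 K)" for n
    by (rule order_trans[OF K ennreal_leI]) simp
  then show ?thesis using that[of "max 1 K"] by simp
qed

section \<open>Convergence in measure and convergence in the target space\<close>

theorem theorem4p7:
  fixes M :: "'a measure"
    and NX NY NZ :: "('a \<Rightarrow> ereal) \<Rightarrow> ennreal"
    and u :: "nat \<Rightarrow> 'a \<Rightarrow> ereal"
  assumes "sigma_finite_measure M"
    and "nonatomic M"
    and "emeasure M (space M) = \<infinity>"
    and "quasi_banach_function_norm M NX"
    and "quasi_banach_function_norm M NY"
    and "quasi_banach_function_norm M NZ"
    and "admissible M NX"
    and "almost_compact_infty M NX NZ"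
    and "almost_compact_loc M NY NZ"
    and "\<And>n. u n \<in> borel_measurable M"
    and "bounded_in_space M NX (range u)"
    and "bounded_in_space M NY (range u)"
    and "\<And>\<epsilon>::real. \<epsilon> > 0 \<Longrightarrow>
           (\<lambda>n. emeasure M {x \<in> space M. \<bar>u n x\<bar> > ereal \<epsilon>}) \<longlonglongrightarrow> 0"
  shows "(\<lambda>n. fnorm NZ (u n)) \<longlonglongrightarrow> 0"
proof (rule order_tendstoI)
  fix y :: ennreal
  assume "y < 0"
  then show "\<forall>\<^sub>F n in sequentially. y < fnorm NZ (u n)" by simp
next
  fix y :: ennreal
  assume "0 < y"
  \<comment> \<open>\<open>y\<close> may be infinite; a smaller positive \<open>z\<close> is a real
    number \<open>e\<close>, and the gap below \<open>y\<close> turns the final bound by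
    \<open>e\<close> into a strict one.\<close>
  then obtain z where z: "0 < z" "z < y" using dense by blast
  then obtain e :: real where e: "z = ennreal e" "e > 0"
    by (cases z) (auto simp: top_unique)
  note meas [measurable] = assms(10)
  obtain KX where KX: "KX > 0" "\<And>n. fnorm NX (u n) \<le> ennreal KX"
    using bounded_in_space_rangeD[OF assms(11)] by blast
  obtain KY where KY: "KY > 0" "\<And>n. fnorm NY (u n) \<le> ennreal KY"
    using bounded_in_space_rangeD[OF assms(12)] by blast
  obtain C :: real where C: "C \<ge> 1"
    "\<And>f g h. f \<in> borel_measurable M \<Longrightarrow> g \<in> borel_measurable M \<Longrightarrow> h \<in> borel_measurable M \<Longrightarrow>
       AE x in M. \<bar>f x\<bar> \<le> \<bar>g x\<bar> + \<bar>h x\<bar> \<Longrightarrow> fnorm NZ f \<le> ennreal C * (fnorm NZ g + fnorm NZ h)"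
    using fnorm_quasi_triangle[OF assms(6)] by blast
  \<comment> \<open>\<open>D\<close> collects the constants of two nested quasi-triangle
    inequalities, whose three terms will be at most \<open>KY * r\<close>, \<open>KX * r\<close> and
    \<open>r\<close>; hence \<open>r = e / D\<close>.\<close>
  define D where "D = C * (KY + C * (KX + 1))"
  have "D > 0" using C(1) KX(1) KY(1) by (auto simp: D_def intro!: mult_pos_pos add_pos_pos)
  define r where "r = e / D"
  have r: "r > 0" using \<open>D > 0\<close> e by (simp add: r_def)
  have e_eq: "C * (KY * r + C * (KX * r + r)) = e"
  proof -
    have "C * (KY * r + C * (KX * r + r)) = D * r" by (simp add: D_def algebra_simps)
    then show ?thesis using \<open>D > 0\<close> by (simp add: r_def)
  qed
  obtain a where a: "a > 0" "\<And>f E. f \<in> borel_measurable M \<Longrightarrow> fnorm NY f \<le> ennreal KY \<Longrightarrow>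
      E \<in> sets M \<Longrightarrow> emeasure M E \<le> ennreal a \<Longrightarrow>
      fnorm NZ (\<lambda>x. f x * indicator E x) \<le> ennreal (KY * r)"
    using almost_compact_locD[OF assms(5,6,9) KY(1) r] by blast
  obtain b where b: "b > 0" "\<And>f. f \<in> borel_measurable M \<Longrightarrow> fnorm NX f \<le> ennreal KX \<Longrightarrow>
      \<exists>E \<in> sets M. emeasure M E \<le> ennreal b \<and>
        fnorm NZ (\<lambda>x. f x * indicator (space M - E) x) \<le> ennreal (KX * r)"
    using almost_compact_inftyD[OF assms(4,6,8) KX(1) r] by blast
  obtain B0 :: real where B0: "\<And>E. E \<in> sets M \<Longrightarrow> emeasure M E \<le> ennreal b \<Longrightarrow>
      fnorm NZ (indicator E) \<le> ennreal B0"
    using fnorm_indicator_bounded[OF assms(2,6) b(1)] by blast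
  \<comment> \<open>Made positive so that \<open>\<delta> = r / B\<close> is a positive level, for
    which \<open>\<delta>\<close> times any indicator norm in question is at most
    \<open>r\<close>.\<close>
  define B where "B = max 1 B0"
  have B: "fnorm NZ (indicator E) \<le> ennreal B"
    if "E \<in> sets M" "emeasure M E \<le> ennreal b" for E
    using order_trans[OF B0[OF that] ennreal_leI[of B0 B]] by (auto simp: B_def)
  have "B > 0" by (simp add: B_def)
  define \<delta> where "\<delta> = r / B"
  have \<delta>: "\<delta> > 0" "\<delta> * B = r" using r \<open>B > 0\<close> by (auto simp: \<delta>_def)
  have "\<forall>\<^sub>F n in sequentially. emeasure M {x \<in> space M. \<bar>u n x\<bar> > ereal \<delta>} < ennreal a"
    using order_tendstoD(2)[OF assms(13)[OF \<delta>(1)]] a(1) by simp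
  then show "\<forall>\<^sub>F n in sequentially. fnorm NZ (u n) < y"
  proof eventually_elim
    case (elim n)
    define G where "G = {x \<in> space M. \<bar>u n x\<bar> > ereal \<delta>}"
    have G [measurable]: "G \<in> sets M" unfolding G_def by measurable
    have 1: "fnorm NZ (\<lambda>x. u n x * indicator G x) \<le> ennreal (KY * r)"
      using elim KY(2) by (intro a(2)) (auto simp: G_def[symmetric])
    obtain E where E [measurable]: "E \<in> sets M" and Eb: "emeasure M E \<le> ennreal b"
      and 2: "fnorm NZ (\<lambda>x. u n x * indicator (space M - E) x) \<le> ennreal (KX * r)"
      using b(2)[OF meas KX(2)] by blast
    have "fnorm NZ (\<lambda>x. ereal \<delta> * indicator E x) = ennreal \<delta> * fnorm NZ (indicator E)"
      using \<delta>(1) by (intro fnorm_scale[OF assms(6)]) auto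
    also have "\<dots> \<le> ennreal \<delta> * ennreal B"
      using B[OF E Eb] by (rule mult_left_mono) simp
    also have "\<dots> = ennreal r"
      using \<delta> \<open>B > 0\<close> by (simp add: ennreal_mult''[symmetric])
    finally have 3: "fnorm NZ (\<lambda>x. ereal \<delta> * indicator E x) \<le> ennreal r" .
    \<comment> \<open>Groups two of the three terms, since the quasi-triangle inequality handles two
      at a time.\<close>
    define w where "w x = \<bar>u n x * indicator (space M - E) x\<bar> + \<bar>ereal \<delta> * indicator E x\<bar>" for x
    have w [measurable]: "w \<in> borel_measurable M" unfolding w_def by measurable
    have "fnorm NZ w \<le> ennreal C * (fnorm NZ (\<lambda>x. u n x * indicator (space M - E) x)
        + fnorm NZ (\<lambda>x. ereal \<delta> * indicator E x))"
      by (rule C(2)) (auto simp: w_def)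
    also have "\<dots> \<le> ennreal C * (ennreal (KX * r) + ennreal r)"
      using add_mono[OF 2 3] by (rule mult_left_mono) simp
    finally have 4: "fnorm NZ w \<le> ennreal C * (ennreal (KX * r) + ennreal r)" .
    have "fnorm NZ (u n) \<le> ennreal C * (fnorm NZ (\<lambda>x. u n x * indicator G x) + fnorm NZ w)"
    proof (intro C(2) AE_I2)
      fix x assume x: "x \<in> space M"
      show "\<bar>u n x\<bar> \<le> \<bar>u n x * indicator G x\<bar> + \<bar>w x\<bar>"
      \<comment> \<open>On \<open>G\<close> the first term suffices. Off \<open>G\<close>,
        \<open>w\<close> dominates: for \<open>x\<close> in \<open>E\<close> through the level
        \<open>\<delta>\<close>, and otherwise because its first summand is the absolute value of
        \<open>u n x\<close> itself.\<close>
      proof (cases "x \<in> G")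
        case True
        then show ?thesis by (simp add: add_increasing2)
      next
        case False
        with x have "\<bar>u n x\<bar> \<le> ereal \<delta>" by (simp add: G_def not_less)
        with False x \<delta>(1) show ?thesis by (cases "x \<in> E") (auto simp: w_def)
      qed
    qed measurable
    also have "\<dots> \<le> ennreal C * (ennreal (KY * r) + ennreal C * (ennreal (KX * r) + ennreal r))"
      using add_mono[OF 1 4] by (rule mult_left_mono) simp
    also have "\<dots> = ennreal (C * (KY * r + C * (KX * r + r)))"
      using C(1) KX(1) KY(1) r
      by (simp add: ennreal_mult''[symmetric] ennreal_plus[symmetric] del: ennreal_plus)
    also have "\<dots> < y"
      using e_eq e(1) z(2) by simp
    finally show ?case .
  qed
qed

end
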